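(* For $\mu\in\mathbb{R}\setminus 2\pi\mathbb{Z}$ and $k=1,2,\dots$, \[ \widetilde{\mathcal{Z}}(k;\mu):=\sum_{m\in\mathbb{Z}}\frac{1}{(2m\pi-\mu)^{k+1}}=\frac{1}{2\cdot k!}\,i^{k+1}e^{i\mu}\,\mathcal{E}_k\big(1;-e^{i\mu}\big), \] where $\mathcal{E}_k(x;\lambda)$ are the Apostol-Euler polynomials.
   Context: For $\lambda\in\mathbb{C}\setminus\{0,-1\}$, the Apostol-Euler polynomials $\mathcal{E}_k(x;\lambda)$ are defined by the generating function $\frac{2e^{xz}}{\lambda e^z+1}=\sum_{k=0}^\infty \mathcal{E}_k(x;\lambda)\frac{z^k}{k!}$, a power series in $z$ convergent in a neighborhood of $z=0$. *)

theory Defs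
  imports "HOL-Analysis.Analysis"
begin

definition apostol_euler_gf :: "complex \<Rightarrow> complex \<Rightarrow> complex fps" where
  "apostol_euler_gf x lam =
     (fps_const 2 * fps_exp x) / (fps_const lam * fps_exp 1 + 1)"

text \<open>Meaningful only for \<open>lam \<noteq> -1\<close>, where the constant coefficient \<open>lam + 1\<close> of the
  denominator is a unit, so that the quotient is the genuine one.\<close>

definition apostol_euler :: "nat \<Rightarrow> complex \<Rightarrow> complex \<Rightarrow> complex" where
  "apostol_euler k x lam = fact k * fps_nth (apostol_euler_gf x lam) k"

lemma has_fps_expansion_apostol_euler_gf:
  assumes "lam \<noteq> -1"
  shows "(\<lambda>z. 2 * exp (x * z) / (lam * exp z + 1)) has_fps_expansion apostol_euler_gf x lam"
proof -
  have "lam + 1 \<noteq> 0"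
    using assms by (simp add: add_eq_0_iff2)
  have n: "(\<lambda>z. 2 * exp (x * z)) has_fps_expansion fps_const 2 * fps_exp x"
    by (intro fps_expansion_intros)
  have "(\<lambda>z. lam * exp (1 * z) + 1) has_fps_expansion fps_const lam * fps_exp 1 + 1"
    by (intro fps_expansion_intros)
  then have d: "(\<lambda>z. lam * exp z + 1) has_fps_expansion fps_const lam * fps_exp 1 + 1"
    by simp
  show ?thesis
    unfolding apostol_euler_gf_def
    by (rule has_fps_expansion_divide'[OF n d]) (use \<open>lam + 1 \<noteq> 0\<close> in simp)
qed

lemma apostol_euler_sums:
  assumes "lam \<noteq> -1"
  shows "\<forall>\<^sub>F z in nhds 0.
    (\<lambda>k. apostol_euler k x lam * z ^ k / fact k) sums (2 * exp (x * z) / (lam * exp z + 1))"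
proof -
  let ?F = "apostol_euler_gf x lam"
  have F: "fps_conv_radius ?F > 0"
    "\<forall>\<^sub>F z in nhds 0. eval_fps ?F z = 2 * exp (x * z) / (lam * exp z + 1)"
    using has_fps_expansion_apostol_euler_gf[OF assms, of x]
    by (auto simp: has_fps_expansion_def)
  have "\<forall>\<^sub>F z in nhds 0. z \<in> eball 0 (fps_conv_radius ?F)"
    using F(1) by (intro eventually_nhds_in_open) (auto simp: zero_ereal_def)
  with F(2) show ?thesis
  proof eventually_elim
    case (elim z)
    then have "(\<lambda>k. fps_nth ?F k * z ^ k) sums eval_fps ?F z"
      by (intro sums_eval_fps) (auto simp: in_eball_iff)
    then show ?case
      using elim by (simp add: apostol_euler_def)
  qed
qed

definition Z_tilde :: "nat \<Rightarrow> real \<Rightarrow> real" where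
  "Z_tilde k mu = (\<Sum>\<^sub>\<infinity>m::int. 1 / (2 * of_int m * pi - mu) ^ (k + 1))"

end

theory Submission
  imports Defs
begin

text \<open>Up to rescaling by \<open>2\<pi>\<close>, the two halves \<open>m \<ge> 0\<close> and \<open>m < 0\<close> of the series are polygamma
  series at \<open>x = -\<mu>/(2\<pi>)\<close> and \<open>1 - x\<close>. The reflection formula
  \<open>\<psi>(1 - s) - \<psi>(s) = \<pi> cot (\<pi>s)\<close> along the line \<open>s = (\<i>z - \<mu>)/(2\<pi>)\<close> identifies the
  \<open>k\<close>-th \<open>z\<close>-derivative of their combination at \<open>0\<close> with that of the generating function, because
  \<open>\<pi> cot (\<pi>s) = \<pi>\<i> (1 + 2 / (exp (2\<pi>\<i>s) - 1))\<close>.\<close>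

lemma one_minus_in_Ints_iff: "1 - z \<in> \<int> \<longleftrightarrow> z \<in> \<int>" for z :: "'a :: ring_1"
  using Ints_diff[OF Ints_1, of z] Ints_diff[OF Ints_1, of "1 - z"] by auto

lemma notin_Ints_imp_notin_nonpos_Ints: "z \<notin> \<int> \<Longrightarrow> z \<notin> \<int>\<^sub>\<le>\<^sub>0"
  using nonpos_Ints_Int by blast

text \<open>This is the logarithmic derivative of the reflection formula
  \<open>rGamma z * rGamma (1 - z) = sin (pi * z) / pi\<close>: both sides are differentiated and
  the results compared.\<close>

lemma Digamma_reflection_complex:
  fixes z :: complex
  assumes "z \<notin> \<int>"
  shows "Digamma (1 - z) - Digamma z = of_real pi * cot (of_real pi * z)"
proof -
  have z: "z \<notin> \<int>\<^sub>\<le>\<^sub>0" "1 - z \<notin> \<int>\<^sub>\<le>\<^sub>0"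
    using assms notin_Ints_imp_notin_nonpos_Ints by (auto simp: one_minus_in_Ints_iff)
  have "((\<lambda>z. rGamma z * rGamma (1 - z)) has_field_derivative
      rGamma z * rGamma (1 - z) * (Digamma (1 - z) - Digamma z)) (at z)"
    using z by (auto intro!: derivative_eq_intros simp: algebra_simps)
  then have "((\<lambda>z. sin (of_real pi * z) / of_real pi) has_field_derivative
      sin (of_real pi * z) / of_real pi * (Digamma (1 - z) - Digamma z)) (at z)"
    by (simp only: rGamma_reflection_complex)
  moreover have "((\<lambda>z. sin (of_real pi * z) / of_real pi) has_field_derivative
      cos (of_real pi * z)) (at z)"
    by (auto intro!: derivative_eq_intros)
  ultimately have "sin (of_real pi * z) / of_real pi * (Digamma (1 - z) - Digamma z) =
      cos (of_real pi * z)"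
    by (rule DERIV_unique)
  \<comment> \<open>\<open>rGamma\<close> vanishes only at nonpositive integers, so neither factor
    of the product is zero here.\<close>
  moreover have "sin (of_real pi * z) \<noteq> 0"
    using z rGamma_reflection_complex[of z] by (auto simp: rGamma_eq_zero_iff)
  ultimately show ?thesis
    by (simp add: cot_def field_simps)
qed

lemma cot_complex_exp:
  fixes z :: complex
  assumes "exp (2 * \<i> * z) \<noteq> 1"
  shows "cot z = \<i> * (1 + 2 / (exp (2 * \<i> * z) - 1))"
proof -
  define e where "e = exp (\<i> * z)"
  have e: "e \<noteq> 0" "exp (- (\<i> * z)) = inverse e" "exp (2 * \<i> * z) = e\<^sup>2"
    by (simp_all add: e_def exp_minus exp_double[symmetric] mult.assoc)
  have "e\<^sup>2 - 1 \<noteq> 0"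
    using assms e by simp
  have "cot z = \<i> * (e + inverse e) / (e - inverse e)"
  proof -
    \<comment> \<open>For \<open>q = 0\<close> both sides are 0 by the convention for division by
      zero.\<close>
    have "(p / 2) / (q / (2 * \<i>)) = \<i> * p / q" for p q :: complex
      by (cases "q = 0") (simp_all add: field_simps)
    then show ?thesis
      unfolding cot_def sin_exp_eq cos_exp_eq e(2) e_def[symmetric] .
  qed
  also have "\<dots> = \<i> * ((e\<^sup>2 + 1) / (e\<^sup>2 - 1))"
    using e(1) by (simp add: divide_simps power2_eq_square)
  also have "(e\<^sup>2 + 1) / (e\<^sup>2 - 1) = 1 + 2 / (e\<^sup>2 - 1)"
    using \<open>e\<^sup>2 - 1 \<noteq> 0\<close> by (simp add: field_simps)
  finally show ?thesis
    by (simp only: e)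
qed

text \<open>Each derivative raises the polygamma order and brings out the inner derivative,
  \<open>a\<close> for one term and \<open>- a\<close> for the reflected one; hence the relative
  sign \<open>(-1) ^ n\<close>.\<close>

lemma higher_deriv_Digamma_reflected:
  fixes a c z :: complex
  assumes "a * z + c \<notin> \<int>"
  shows "(deriv ^^ n) (\<lambda>z. Digamma (1 - (a * z + c)) - Digamma (a * z + c)) z =
    a ^ n * ((-1) ^ n * Polygamma n (1 - (a * z + c)) - Polygamma n (a * z + c))"
  using assms
proof (induction n arbitrary: z)
  case 0
  then show ?case by simp
next
  case (Suc n)
  \<comment> \<open>The integers are closed, so the induction hypothesis holds in a neighbourhood of
    \<open>z\<close> and can be differentiated at \<open>z\<close>.\<close>
  have "open ((\<lambda>z. a * z + c) -` (- \<int>))"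
    by (intro open_vimage continuous_intros) (auto simp: closed_Ints)
  then have ev: "\<forall>\<^sub>F w in nhds z. a * w + c \<notin> \<int>"
    using Suc.prems eventually_nhds_in_open by fastforce
  have "a * z + c \<notin> \<int>\<^sub>\<le>\<^sub>0" "1 - (a * z + c) \<notin> \<int>\<^sub>\<le>\<^sub>0"
    using Suc.prems notin_Ints_imp_notin_nonpos_Ints one_minus_in_Ints_iff by blast+
  note D = this[THEN has_field_derivative_Polygamma, of n UNIV]
  have "((\<lambda>z. a ^ n * ((-1) ^ n * Polygamma n (1 - (a * z + c)) - Polygamma n (a * z + c)))
      has_field_derivative a ^ n * ((-1) ^ n * (Polygamma (Suc n) (1 - (a * z + c)) * - a)
        - Polygamma (Suc n) (a * z + c) * a)) (at z)"
    by (intro DERIV_cmult DERIV_diff DERIV_chain2[where g = "\<lambda>z. a * z + c", OF D(1)]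
        DERIV_chain2[where g = "\<lambda>z. 1 - (a * z + c)", OF D(2)])
      (auto intro!: derivative_eq_intros)
  then have "deriv (\<lambda>z. a ^ n * ((-1) ^ n * Polygamma n (1 - (a * z + c)) - Polygamma n (a * z + c))) z
      = a ^ Suc n * ((-1) ^ Suc n * Polygamma (Suc n) (1 - (a * z + c)) - Polygamma (Suc n) (a * z + c))"
    by (intro DERIV_imp_deriv) (simp add: algebra_simps)
  moreover have "deriv ((deriv ^^ n) (\<lambda>z. Digamma (1 - (a * z + c)) - Digamma (a * z + c))) z =
      deriv (\<lambda>z. a ^ n * ((-1) ^ n * Polygamma n (1 - (a * z + c)) - Polygamma n (a * z + c))) z"
    by (intro deriv_cong_ev eventually_mono[OF ev] Suc.IH refl)
  ultimately show ?case by simp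
qed

text \<open>The terms with \<open>m \<ge> 0\<close> form the polygamma series at \<open>x\<close>.
  Putting \<open>m = - n - 1\<close> gives \<open>m + x = - (n + (1 - x))\<close>, so the others
  form the series at \<open>1 - x\<close>, with a sign that cancels the one in that series.\<close>

lemma has_sum_inverse_power_int_shift:
  fixes x :: real
  assumes "x \<notin> \<int>" "k \<ge> 1"
  shows "((\<lambda>m::int. 1 / (of_int m + x) ^ (k + 1)) has_sum
    ((-1) ^ (k + 1) * Polygamma k x + Polygamma k (1 - x)) / fact k) UNIV"
proof -
  have half: "((\<lambda>n::nat. 1 / (of_nat n + y) ^ (k + 1)) has_sum
      (-1) ^ (k + 1) * Polygamma k y / fact k) UNIV" if "y \<notin> \<int>" for y :: real
  proof (rule sums_nonneg_imp_has_sum_strong)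
    show "(\<lambda>n. 1 / (of_nat n + y) ^ (k + 1)) sums ((-1) ^ (k + 1) * Polygamma k y / fact k)"
    proof -
      have "y \<noteq> 0" using that by auto
      then show ?thesis
        using Polygamma_LIMSEQ[of y k] assms(2) by (simp add: field_simps)
    qed
    \<comment> \<open>Eventual nonnegativity upgrades the ordered convergence of the series to the
      unconditional \<open>has_sum\<close>; only finitely many \<open>n\<close> have
      \<open>n + y < 0\<close>.\<close>
    show "\<forall>\<^sub>F n in sequentially. 0 \<le> 1 / (real n + y) ^ (k + 1)"
      using eventually_ge_at_top[of "nat \<lceil>- y\<rceil>"]
    proof eventually_elim
      case (elim n)
      then have "0 \<le> real n + y" by linarith
      then show ?case by simp
    qed
  qed
  let ?g = "\<lambda>m::int. 1 / (of_int m + x) ^ (k + 1)"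
  have "(?g has_sum (-1) ^ (k + 1) * Polygamma k x / fact k) (range int)"
    using half[OF assms(1)] by (subst has_sum_reindex) (auto simp: o_def)
  moreover have "(?g has_sum Polygamma k (1 - x) / fact k) (range (\<lambda>n. - int n - 1))"
  proof -
    have "(?g \<circ> (\<lambda>n. - int n - 1)) =
        (\<lambda>n. (-1) ^ (k + 1) * (1 / (of_nat n + (1 - x)) ^ (k + 1)))"
    proof
      fix n :: nat
      have "of_int (- int n - 1) + x = (-1) * (of_nat n + (1 - x))"
        by simp
      then show "(?g \<circ> (\<lambda>n. - int n - 1)) n = (-1) ^ (k + 1) * (1 / (of_nat n + (1 - x)) ^ (k + 1))"
        unfolding o_def by (simp only: power_mult_distrib) (simp add: divide_simps)
    qed
    moreover have "((\<lambda>n. (-1) ^ (k + 1) * (1 / (of_nat n + (1 - x)) ^ (k + 1))) has_sum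
        (-1) ^ (k + 1) * ((-1) ^ (k + 1) * Polygamma k (1 - x) / fact k)) (UNIV :: nat set)"
      using assms(1) by (intro has_sum_cmult_right half) (simp add: one_minus_in_Ints_iff)
    ultimately show ?thesis
      by (subst has_sum_reindex) (auto simp: inj_on_def)
  qed
  moreover have "range int \<inter> range (\<lambda>n. - int n - 1) = {}"
    by auto
  ultimately have "(?g has_sum (-1) ^ (k + 1) * Polygamma k x / fact k + Polygamma k (1 - x) / fact k)
      (range int \<union> range (\<lambda>n. - int n - 1))"
    by (rule has_sum_Un_disjoint)
  moreover have "range int \<union> range (\<lambda>n. - int n - 1) = UNIV"
  proof (intro set_eqI iffI UNIV_I)
    fix m :: int
    show "m \<in> range int \<union> range (\<lambda>n. - int n - 1)"
    proof (cases "m \<ge> 0")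
      case True
      then have "m = int (nat m)" by simp
      then show ?thesis by blast
    next
      case False
      then have "m = - int (nat (- m - 1)) - 1" by simp
      then show ?thesis by blast
    qed
  qed
  ultimately show ?thesis
    by (simp only: add_divide_distrib)
qed

text \<open>The \<open>k\<close>-th Taylor coefficient at 0 of a single function is computed twice:
  from the generating function at \<open>- L\<close>, and from polygamma values along the line
  \<open>a * z + c\<close>.\<close>

lemma apostol_euler_one_eq_Polygamma:
  fixes mu :: real
  defines "c \<equiv> - complex_of_real mu / (2 * of_real pi)"
  assumes c: "c \<notin> \<int>" and k: "k \<ge> 1"
  shows "of_real pi * \<i> * exp (\<i> * of_real mu) * apostol_euler k 1 (- exp (\<i> * of_real mu)) =
    (\<i> / (2 * of_real pi)) ^ k * ((-1) ^ k * Polygamma k (1 - c) - Polygamma k c)"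
proof -
  define L where "L = exp (\<i> * of_real mu)"
  define a where "a = \<i> / (2 * of_real pi)"
  let ?F = "fps_const (of_real pi * \<i>) * (1 + fps_const L * apostol_euler_gf 1 (- L))"
  let ?f = "\<lambda>z. of_real pi * \<i> * (1 + L * (2 * exp (1 * z) / (- L * exp z + 1)))"
  let ?g = "\<lambda>z. Digamma (1 - (a * z + c)) - Digamma (a * z + c)"
  \<comment> \<open>The constants \<open>a\<close> and \<open>c\<close> are chosen to make this
    exponent equal to \<open>- (\<i> * mu + z)\<close>.\<close>
  have exp_eq: "exp (2 * \<i> * (of_real pi * (a * z + c))) = inverse (L * exp z)" for z
  proof -
    have "2 * \<i> * (of_real pi * (a * z + c)) = - (\<i> * of_real mu + z)"
      by (simp add: a_def c_def field_simps)
    then show ?thesis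
      by (simp only: L_def exp_minus exp_add)
  qed
  have ne: "L * exp z \<noteq> 1" if "a * z + c \<notin> \<int>" for z
  proof
    assume "L * exp z = 1"
    then have "exp (2 * \<i> * (of_real pi * (a * z + c))) = 1"
      by (simp add: exp_eq)
    then obtain n :: int where "2 * \<i> * (of_real pi * (a * z + c)) = of_int (2 * n) * of_real pi * \<i>"
      using Complex_Transcendental.exp_eq[of "2 * \<i> * (of_real pi * (a * z + c))" 0] by auto
    then have "a * z + c = of_int n"
      by simp
    with that show False by simp
  qed
  have g_eq: "?g z = ?f z" if "a * z + c \<notin> \<int>" for z
  proof -
    have q: "exp (2 * \<i> * (of_real pi * (a * z + c))) \<noteq> 1"
      using ne[OF that] by (simp only: exp_eq inverse_eq_1_iff not_False_eq_True)
    have "?g z = of_real pi * cot (of_real pi * (a * z + c))"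
      by (rule Digamma_reflection_complex[OF that])
    also have "\<dots> = of_real pi * (\<i> * (1 + 2 / (inverse (L * exp z) - 1)))"
      by (subst cot_complex_exp[OF q]) (simp only: exp_eq)
    \<comment> \<open>With \<open>w = L * exp z\<close> this is
      \<open>2 / (1 / w - 1) = 2 * w / (1 - w)\<close>, which exhibits the generating function for
      \<open>x = 1\<close> and \<open>lam = - L\<close>.\<close>
    also have "2 / (inverse (L * exp z) - 1) = L * (2 * exp (1 * z) / (- L * exp z + 1))"
      using ne[OF that] by (simp add: L_def divide_simps)
    finally show ?thesis by simp
  qed
  have "open ((\<lambda>z. a * z + c) -` (- \<int>))"
    by (intro open_vimage continuous_intros) (auto simp: closed_Ints)
  then have ev: "\<forall>\<^sub>F z in nhds 0. a * z + c \<notin> \<int>"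
    using c eventually_nhds_in_open[of "(\<lambda>z. a * z + c) -` (- \<int>)" 0] by simp
  have "L \<noteq> 1"
    using ne[of 0] c by simp
  then have "?f has_fps_expansion ?F"
    by (intro fps_expansion_intros has_fps_expansion_apostol_euler_gf) auto
  then have "fps_nth ?F k = (deriv ^^ k) ?f 0 / fact k"
    by (rule fps_nth_fps_expansion)
  also have "(deriv ^^ k) ?f 0 = (deriv ^^ k) ?g 0"
    by (intro higher_deriv_cong_ev eventually_mono[OF ev] g_eq[symmetric] refl)
  also have "\<dots> = a ^ k * ((-1) ^ k * Polygamma k (1 - c) - Polygamma k c)"
    using higher_deriv_Digamma_reflected[of a 0 c k] c by simp
  finally show ?thesis
    \<comment> \<open>The summand 1 in \<open>?F\<close> contributes only to the constant
      coefficient, so it disappears for \<open>k \<ge> 1\<close>.\<close>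
    unfolding L_def[symmetric] a_def[symmetric] using k
    by (simp add: apostol_euler_def field_simps)
qed

text \<open>Since a divergent infinite sum defaults to 0, the summability conjunct certifies that
  \<open>Z_tilde\<close> is the genuine value of the series.\<close>

theorem theorem4:
  fixes mu :: real and k :: nat
  assumes "\<forall>m::int. mu \<noteq> 2 * pi * of_int m" and "k \<ge> 1"
  shows "(\<lambda>m::int. 1 / (2 * of_int m * pi - mu) ^ (k + 1)) summable_on UNIV \<and>
    complex_of_real (Z_tilde k mu) =
      1 / (2 * fact k) * \<i> ^ (k + 1) * exp (\<i> * of_real mu)
        * apostol_euler k 1 (- exp (\<i> * of_real mu))"
proof -
  define x where "x = - mu / (2 * pi)"
  let ?P = "((-1) ^ (k + 1) * Polygamma k x + Polygamma k (1 - x)) / fact k"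
  let ?E = "exp (\<i> * of_real mu) * apostol_euler k 1 (- exp (\<i> * of_real mu))"
  have x: "x \<notin> \<int>"
  proof
    assume "x \<in> \<int>"
    then obtain n where "x = of_int n" by (elim Ints_cases)
    then have "mu = 2 * pi * of_int (- n)"
      by (simp add: x_def field_simps)
    then show False using assms(1) by blast
  qed
  have "((\<lambda>m::int. 1 / (2 * pi) ^ (k + 1) * (1 / (of_int m + x) ^ (k + 1))) has_sum
      1 / (2 * pi) ^ (k + 1) * ?P) UNIV"
    by (intro has_sum_cmult_right has_sum_inverse_power_int_shift x assms(2))
  moreover have "1 / (2 * pi) ^ (k + 1) * (1 / (of_int m + x) ^ (k + 1)) =
      1 / (2 * of_int m * pi - mu) ^ (k + 1)" for m :: int
  proof -
    have "2 * of_int m * pi - mu = 2 * pi * (of_int m + x)"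
      by (simp add: x_def field_simps)
    then show ?thesis
      by (simp only: power_mult_distrib) simp
  qed
  ultimately have S: "((\<lambda>m::int. 1 / (2 * of_int m * pi - mu) ^ (k + 1)) has_sum
      1 / (2 * pi) ^ (k + 1) * ?P) UNIV"
    by simp
  then have Z: "Z_tilde k mu = 1 / (2 * pi) ^ (k + 1) * ?P"
    unfolding Z_tilde_def by (rule infsumI)
  have c: "- complex_of_real mu / (2 * of_real pi) = of_real x"
    by (simp add: x_def)
  have x0: "x \<noteq> 0" "1 - x \<noteq> 0"
    using x by auto
  have "complex_of_real x \<notin> \<int>"
    using x by simp
  then have "of_real pi * \<i> * ?E = (\<i> / (2 * of_real pi)) ^ k *
      ((-1) ^ k * Polygamma k (1 - complex_of_real x) - Polygamma k (complex_of_real x))"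
    using apostol_euler_one_eq_Polygamma[of mu k] assms(2) by (simp only: c mult.assoc simp_thms)
  \<comment> \<open>Pulling out \<open>(-1) ^ k\<close> leaves the real polygamma combination in
    \<open>?P\<close>, embedded in the complex numbers.\<close>
  also have "(-1) ^ k * Polygamma k (1 - complex_of_real x) - Polygamma k (complex_of_real x) =
      (-1) ^ k * of_real (fact k * ?P)"
  proof -
    have "(-1) ^ k * ((-1) ^ k * w) = w" for w :: complex
      by (simp flip: mult.assoc power_mult_distrib)
    then show ?thesis
      using Polygamma_of_real[OF x0(1), of k, where 'a = complex]
        Polygamma_of_real[OF x0(2), of k, where 'a = complex]
      by (simp add: right_diff_distrib[of "(-1) ^ k"])
  qed
  also have "of_real (fact k * ?P) = of_real (fact k * ((2 * pi) ^ (k + 1) * Z_tilde k mu))"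
    by (simp add: Z)
  finally have "of_real pi * \<i> * ?E = (\<i> / (2 * of_real pi)) ^ k * ((-1) ^ k *
      (fact k * ((2 * of_real pi) ^ (k + 1) * of_real (Z_tilde k mu))))"
    by simp
  also have "\<dots> = of_real pi * (2 * fact k * (- \<i>) ^ k * of_real (Z_tilde k mu))"
    by (simp add: power_divide power_minus[of \<i>] field_simps)
  finally have "\<i> * ?E = 2 * fact k * (- \<i>) ^ k * of_real (Z_tilde k mu)"
    by simp
  \<comment> \<open>Multiplying by \<open>\<i> ^ k\<close> removes \<open>(- \<i>) ^ k\<close>,
    because \<open>\<i> * - \<i> = 1\<close>.\<close>
  then have "\<i> ^ k * (\<i> * ?E) = 2 * fact k * (\<i> * - \<i>) ^ k * of_real (Z_tilde k mu)"
    by (simp only: power_mult_distrib mult_ac)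
  then have "complex_of_real (Z_tilde k mu) = 1 / (2 * fact k) * \<i> ^ (k + 1) * ?E"
    by (simp add: field_simps)
  moreover have "(\<lambda>m::int. 1 / (2 * of_int m * pi - mu) ^ (k + 1)) summable_on UNIV"
    using S by (rule has_sum_imp_summable)
  ultimately show ?thesis
    by (simp add: mult.assoc)
qed

end
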